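(* Let $E$ be a finite set with $|E|\ge 2$, let $K\subseteq\mathbb R_+^E$ be a closed convex cone, let $P=K\cap[0,1]^E$, let $c\in\mathbb R^E$ and assume $\alpha:=\max\{c^\top y:y\in P\}>0$. Let $F=\{y\in P:c^\top y=\alpha\}$ and $I=\bigcap_{y\in F}\operatorname{supp}(y)$. Let $\mathcal C$ be the clutter of inclusion-minimal sets among the supports $\operatorname{supp}(z)$ with $z\in K$ and $c^\top z>0$. Then $I$ is a transversal of $\mathcal C$, i.e. $I\cap C\neq\emptyset$ for every $C\in\mathcal C$. Consequently, $I$ contains a member of the blocker $b(\mathcal C)$.
   Context: For $y\in\mathbb R_+^E$, $\operatorname{supp}(y)=\{e\in E:y_e>0\}$. The blocker $b(\mathcal C)$ of a clutter $\mathcal C$ on $E$ is the family of inclusion-minimal sets $B\subseteq E$ such that $B\cap C\ne\emptyset$ for every $C\in\mathcal C$. *)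

theory Defs
  imports "HOL-Analysis.Analysis"
begin

text \<open>The finite ground set \<open>E\<close> is the universe of a type \<open>'e\<close> of class \<open>finite\<close>, so the
  requirement that members of a family be subsets of \<open>E\<close> is automatic.\<close>

text \<open>Only meant for vectors with nonnegative entries.\<close>

definition supp :: "real ^ 'e \<Rightarrow> 'e set" where
  "supp y = {e. y $ e > 0}"

definition inclusion_minimal :: "'e set set \<Rightarrow> 'e set set" where
  "inclusion_minimal \<F> = {A \<in> \<F>. \<forall>B \<in> \<F>. \<not> B \<subset> A}"

definition transversal :: "'e set set \<Rightarrow> 'e set \<Rightarrow> bool" where
  "transversal \<C> B \<longleftrightarrow> (\<forall>C \<in> \<C>. B \<inter> C \<noteq> {})"

definition blocker :: "'e set set \<Rightarrow> 'e set set" where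
  "blocker \<C> = inclusion_minimal {B. transversal \<C> B}"

end

theory Submission
  imports Defs
begin

text \<open>Let \<open>z \<in> K\<close> have \<open>c \<bullet> z > 0\<close> and suppose that \<open>I\<close> misses \<open>supp z\<close>. Then each coordinate
  \<open>e \<in> supp z\<close> vanishes at some optimal point \<open>y\<^sub>e\<close>. Averaging these points over \<open>supp z\<close> gives an
  optimal point all of whose coordinates on \<open>supp z\<close> lie strictly below the bound \<open>1\<close>. As \<open>K\<close> is
  a convex cone, a small multiple of \<open>z\<close> can be added to the average without leaving the box, and
  this increases the objective beyond its maximum, a contradiction
  (\<open>common_support_of_maximizers_meets_support\<close>). In particular \<open>I\<close> meets the minimal
  supports. Every transversal of a family on a finite ground set contains a minimal one
  (\<open>transversal_contains_blocker_member\<close>), which gives the statement on the blocker. Closedness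
  of \<open>K\<close> makes the feasible region compact, so that \<open>\<alpha>\<close> is indeed an attained maximum.\<close>

lemma transversal_contains_blocker_member:
  fixes \<C> :: "'e::finite set set"
  assumes "transversal \<C> I"
  shows "\<exists>B \<in> blocker \<C>. B \<subseteq> I"
proof -
  have "\<exists>B \<in> {B. transversal \<C> B}. B \<subseteq> I \<and> (\<forall>A \<in> {B. transversal \<C> B}. A \<subseteq> B \<longrightarrow> B = A)"
    using assms by (intro finite_has_minimal2) auto
  then show ?thesis
    unfolding blocker_def inclusion_minimal_def by blast
qed

lemma convex_cone_sum_mem:
  assumes "convex K" "cone K" "0 \<in> K" "\<And>i. i \<in> A \<Longrightarrow> f i \<in> K"
  shows "sum f A \<in> K"
  using assms(4)
proof (induction A rule: infinite_finite_induct)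
  case (insert i A)
  then show ?case
    using assms(1,2) convex_cone[of K] by auto
qed (use assms(3) in auto)

text \<open>The box bound survives the perturbation because of the exact trade-off used here: among the
  \<open>n = card (supp z)\<close> optimal points, the one chosen for \<open>e\<close> contributes \<open>0\<close> at \<open>e\<close>, and this
  leaves room for the coordinate of the unit vector \<open>z / norm z\<close>, which is at most \<open>1\<close>.\<close>

lemma common_support_of_maximizers_meets_support:
  fixes K :: "(real ^ 'e::finite) set"
  defines "P \<equiv> K \<inter> {y. \<forall>e. 0 \<le> y $ e \<and> y $ e \<le> 1}"
  assumes nonneg: "K \<subseteq> {y. \<forall>e. 0 \<le> y $ e}"
    and K: "convex K" "cone K"
    and le: "\<And>y. y \<in> P \<Longrightarrow> c \<bullet> y \<le> \<alpha>"
    and z: "z \<in> K" "c \<bullet> z > 0"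
  shows "(\<Inter>y\<in>{y \<in> P. c \<bullet> y = \<alpha>}. supp y) \<inter> supp z \<noteq> {}"
proof
  assume "(\<Inter>y\<in>{y \<in> P. c \<bullet> y = \<alpha>}. supp y) \<inter> supp z = {}"
  then have "\<forall>e \<in> supp z. \<exists>y. y \<in> P \<and> c \<bullet> y = \<alpha> \<and> e \<notin> supp y"
    by blast
  then obtain y where y: "\<And>e. e \<in> supp z \<Longrightarrow> y e \<in> P \<and> c \<bullet> y e = \<alpha> \<and> e \<notin> supp (y e)"
    by metis
  have yK: "y e \<in> K" and y_nonneg: "0 \<le> y e $ i" and y_le: "y e $ i \<le> 1"
    if "e \<in> supp z" for e i
    using y[OF that] by (auto simp: P_def)
  have y_zero: "y e $ e = 0" if "e \<in> supp z" for e
    using y[OF that] y_nonneg[OF that, of e] by (auto simp: supp_def)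
  have "z \<noteq> 0" using z by auto
  have off: "z $ i = 0" if "i \<notin> supp z" for i
  proof -
    have "0 \<le> z $ i" using nonneg z(1) by auto
    with that show ?thesis by (auto simp: supp_def)
  qed
  have "supp z \<noteq> {}"
    using off \<open>z \<noteq> 0\<close> by (auto simp: vec_eq_iff)
  then have n: "card (supp z) > 0" by (simp add: card_gt_0_iff)
  define s where "s = (\<Sum>e\<in>supp z. y e)"
  define u where "u = (1 / norm z) *\<^sub>R z"
  define w where "w = (1 / card (supp z)) *\<^sub>R (s + u)"
  have scale: "a *\<^sub>R x \<in> K" if "x \<in> K" "0 \<le> a" for x a
    using K(2) that unfolding cone_def by blast
  have "0 \<in> K" using scale[OF z(1), of 0] by simp
  then have "s \<in> K"
    unfolding s_def using K yK by (intro convex_cone_sum_mem) auto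
  moreover have "u \<in> K" unfolding u_def by (intro scale z) auto
  ultimately have "s + u \<in> K" using K convex_cone[of K] by auto
  then have "w \<in> K" unfolding w_def by (intro scale) auto
  have "(s + u) $ i \<le> card (supp z)" for i
  proof (cases "i \<in> supp z")
    case True
    have "s $ i = (\<Sum>e\<in>supp z - {i}. y e $ i)"
      unfolding s_def using True y_zero by (simp add: sum.remove)
    also have "\<dots> \<le> of_nat (card (supp z - {i})) * 1"
      by (intro sum_bounded_above) (use y_le in auto)
    also have "\<dots> = real (card (supp z)) - 1"
      using True n by (simp add: of_nat_diff Suc_leI)
    finally have "s $ i \<le> real (card (supp z)) - 1" .
    moreover have "u $ i \<le> 1"
      using component_le_norm_cart[of z i] \<open>z \<noteq> 0\<close> by (simp add: u_def)
    ultimately show ?thesis by simp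
  next
    case False
    have "s $ i \<le> of_nat (card (supp z)) * 1"
      unfolding s_def sum_component by (intro sum_bounded_above) (use y_le in auto)
    then show ?thesis by (simp add: u_def off[OF False])
  qed
  then have "w $ i \<le> 1" for i
    using n by (simp add: w_def divide_le_eq flip: add_divide_distrib)
  then have "w \<in> P"
    using \<open>w \<in> K\<close> nonneg by (auto simp: P_def)
  then have "c \<bullet> w \<le> \<alpha>" by (rule le)
  moreover have "c \<bullet> s = card (supp z) * \<alpha>"
    using y by (simp add: s_def inner_sum_right)
  then have "c \<bullet> w = \<alpha> + (c \<bullet> u) / card (supp z)"
    using \<open>supp z \<noteq> {}\<close> by (simp add: w_def inner_add_right field_simps)
  moreover have "c \<bullet> u > 0"
    using z \<open>z \<noteq> 0\<close> by (simp add: u_def)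
  ultimately show False
    using n by (simp add: divide_le_0_iff)
qed

text \<open>The operator \<open>GREATEST\<close> yields an unspecified value when there is no greatest element, so
  compactness is what allows reading it as the maximum.\<close>

lemma le_Greatest_of_compact:
  fixes f :: "'a::topological_space \<Rightarrow> real"
  assumes "compact P" "continuous_on P f" "x \<in> P"
  shows "f x \<le> (GREATEST a. a \<in> {f y | y. y \<in> P})"
proof -
  obtain m where m: "m \<in> P" "\<And>y. y \<in> P \<Longrightarrow> f y \<le> f m"
    using continuous_attains_sup[of P f] assms by auto
  then have "(GREATEST a. a \<in> {f y | y. y \<in> P}) = f m"
    by (intro Greatest_equality) auto
  then show ?thesis using m assms by simp
qed

theorem corollary2p2:
  fixes K P F :: "(real ^ 'e) set"
    and c :: "real ^ 'e"
    and \<alpha> :: real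
    and I :: "'e set"
    and \<C> :: "'e set set"
  assumes "CARD('e) \<ge> 2"
    and "K \<subseteq> {y. \<forall>e. 0 \<le> y $ e}"
    and "K \<noteq> {}" and "closed K" and "convex K" and "cone K"
    and "P = K \<inter> {y. \<forall>e. 0 \<le> y $ e \<and> y $ e \<le> 1}"
    and "\<alpha> = (GREATEST a. a \<in> {c \<bullet> y | y. y \<in> P})"
    and "\<alpha> > 0"
    and "F = {y \<in> P. c \<bullet> y = \<alpha>}"
    and "I = (\<Inter>y\<in>F. supp y)"
    and "\<C> = inclusion_minimal {supp z | z. z \<in> K \<and> c \<bullet> z > 0}"
  shows "transversal \<C> I \<and> (\<exists>B \<in> blocker \<C>. B \<subseteq> I)"
proof -
  have "{y :: real ^ 'e. \<forall>e. 0 \<le> y $ e \<and> y $ e \<le> 1} = cbox 0 1"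
    by (auto simp: mem_box_cart)
  then have "compact P"
    using assms(4,7) by (simp add: closed_Int_compact)
  then have le: "c \<bullet> y \<le> \<alpha>" if "y \<in> P" for y
    unfolding assms(8) using that
    by (intro le_Greatest_of_compact) (auto intro!: continuous_intros)
  have "I \<inter> supp z \<noteq> {}" if "z \<in> K" "c \<bullet> z > 0" for z
    using common_support_of_maximizers_meets_support[OF assms(2,5,6) _ that, of \<alpha>] le
    unfolding assms(7,10,11) by blast
  then have "transversal \<C> I"
    unfolding assms(12) transversal_def inclusion_minimal_def by blast
  then show ?thesis
    using transversal_contains_blocker_member by blast
qed

end
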